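(* Let $a<-1$, $f(x,y)=\left(y\frac{x+a}{x-1},x+a-1\right)$, and let $R_0,R_1$ and the cones $\mathcal C^u_p$, $\hat{\mathcal C}^u_p$ be as in the context. If $p,\,f(p)\in(R_0\cup R_1)\cap\mathbf R^2$, then the differential $Df_p$ maps vectors of $\hat{\mathcal C}^u_p$ to vectors in $\mathcal C^u_{f(p)}$.
   Context: Fix a real number $a<-1$. Let $\overline{\mathbf R^2}=(\mathbf R\cup\{\infty\})^2$ and let $f(x,y)=\left(y\frac{x+a}{x-1},x+a-1\right)$, a birational map. Put $R_0=[1,\infty]\times[-\infty,-1]$ and $R_1=[-\infty,0]\times[0,\infty]$ in $\overline{\mathbf R^2}$. For $p\in\mathbf R^2$, let $L_p$ be the line through $(0,-1)$ and $p$, $\hat L_p$ the line through $(1,0)$ and $p$, $H_p$ the horizontal line and $V_p$ the vertical line through $p$. For $p\in R_0\cap\mathbf R^2$, $\mathcal C^u_p$ (resp. $\hat{\mathcal C}^u_p$) is the closed cone of tangent vectors at $p$ swept out by rotating counterclockwise from $L_p$ (resp. $\hat L_p$) to $H_p$; i.e. the vectors whose slope lies between the (nonpositive, possibly $-\infty$) slope of $L_p$ (resp. $\hat L_p$) and $0$, inclusive. For $q\in R_1\cap\mathbf R^2$, $\mathcal C^u_q$ (resp. $\hat{\mathcal C}^u_q$) is the closed cone swept out by rotating counterclockwise from $V_q$ to $L_q$ (resp. $\hat L_q$); i.e. the vectors that are vertical or whose slope is at most the (nonpositive) slope of $L_q$ (resp. $\hat L_q$). *)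

theory Defs
  imports "HOL-Analysis.Analysis"
begin

text \<open>The one-point compactification of the real line; \<open>+\<infinity>\<close> and \<open>-\<infinity>\<close> are the same point, so the
  intervals \<open>[1, \<infinity>]\<close> and \<open>[-\<infinity>, -1]\<close> share the endpoint \<open>Infty\<close>.\<close>

datatype rline = Fin real | Infty

definition emb :: "real \<times> real \<Rightarrow> rline \<times> rline" where
  "emb p = (Fin (fst p), Fin (snd p))"

definition R0 :: "(rline \<times> rline) set" where
  "R0 = insert Infty (Fin ` {1..}) \<times> insert Infty (Fin ` {..-1})"

definition R1 :: "(rline \<times> rline) set" where
  "R1 = insert Infty (Fin ` {..0}) \<times> insert Infty (Fin ` {0..})"

text \<open>The affine formula is meaningful as a real map only off the line \<open>x = 1\<close>.\<close>

definition f :: "real \<Rightarrow> real \<times> real \<Rightarrow> real \<times> real" where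
  "f a p = (snd p * ((fst p + a) / (fst p - 1)), fst p + a - 1)"

text \<open>The birational map on the compactified plane: the continuous extension of the formula,
  with value \<open>None\<close> exactly at the indeterminacy points \<open>(1, 0)\<close> and \<open>(-a, \<infinity>)\<close>
  (for \<open>a \<noteq> -1\<close>).\<close>

fun fbar :: "real \<Rightarrow> rline \<times> rline \<Rightarrow> (rline \<times> rline) option" where
  "fbar a (Fin x, Fin y) =
     (if x \<noteq> 1 then Some (emb (f a (x, y)))
      else if y \<noteq> 0 then Some (Infty, Fin a)
      else None)"
| "fbar a (Fin x, Infty) = (if x = -a then None else Some (Infty, Fin (x + a - 1)))"
| "fbar a (Infty, Fin y) = Some (Fin y, Infty)"
| "fbar a (Infty, Infty) = Some (Infty, Infty)"

text \<open>All slopes that matter here are nonpositive, so a vertical direction is given slope \<open>-\<infinity>\<close>.\<close>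

definition slope :: "real \<times> real \<Rightarrow> ereal" where
  "slope w = (if fst w = 0 then -\<infinity> else ereal (snd w / fst w))"

text \<open>Slopes of the line \<open>L\<^sub>p\<close> through \<open>(0, -1)\<close> and \<open>p\<close>, and of its hatted variant through \<open>(1, 0)\<close>
  and \<open>p\<close>. Neither base point lies in \<open>R\<^sub>0 \<union> R\<^sub>1\<close>.\<close>

definition slope_L :: "real \<times> real \<Rightarrow> ereal" where
  "slope_L p = slope (p - (0, -1))"

definition slope_Lhat :: "real \<times> real \<Rightarrow> ereal" where
  "slope_Lhat p = slope (p - (1, 0))"

text \<open>The cone at \<open>p\<close> bounded on one side by the line of slope \<open>s\<close> through \<open>p\<close>. Over \<open>R\<^sub>0\<close> it is
  swept out counterclockwise from that line to the horizontal, over \<open>R\<^sub>1\<close> from the vertical to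
  that line; in the latter case vertical vectors, having slope \<open>-\<infinity>\<close>, are included automatically.
  Being closed, the cones contain \<open>0\<close>. Only points of \<open>R\<^sub>0 \<union> R\<^sub>1\<close> are relevant.\<close>

definition cone_at :: "ereal \<Rightarrow> real \<times> real \<Rightarrow> (real \<times> real) set" where
  "cone_at s p =
     (if emb p \<in> R0 then {w. w = 0 \<or> s \<le> slope w \<and> slope w \<le> 0}
      else {w. w = 0 \<or> slope w \<le> s})"

definition Cu :: "real \<times> real \<Rightarrow> (real \<times> real) set" where
  "Cu p = cone_at (slope_L p) p"

definition Cuhat :: "real \<times> real \<Rightarrow> (real \<times> real) set" where
  "Cuhat p = cone_at (slope_Lhat p) p"

lemma f_has_derivative:
  assumes "fst p \<noteq> 1"
  shows "(f a has_derivative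
     (\<lambda>w. (snd w * ((fst p + a) / (fst p - 1)) - snd p * (1 + a) / (fst p - 1)\<^sup>2 * fst w, fst w)))
     (at p)"
proof -
  define d where "d = fst p - 1"
  have d: "d \<noteq> 0" and x: "fst p = d + 1" using assms by (auto simp: d_def)
  have fst': "((\<lambda>q. fst q + c) has_derivative fst) (at p)" for c :: real
    using has_derivative_add[OF bounded_linear_imp_has_derivative[OF bounded_linear_fst]
        has_derivative_const[of c]] by simp
  have "((\<lambda>q. (fst q + a) / (fst q + (-1))) has_derivative
      (\<lambda>w. (fst w * (fst p + -1) - (fst p + a) * fst w) / ((fst p + -1) * (fst p + -1)))) (at p)"
    by (rule has_derivative_divide'[OF fst' fst']) (use assms in simp)
  from has_derivative_mult[OF bounded_linear_imp_has_derivative[OF bounded_linear_snd] this]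
  have *: "((\<lambda>q. snd q * ((fst q + a) / (fst q - 1))) has_derivative
      (\<lambda>w. snd p * ((fst w * d - (fst p + a) * fst w) / (d * d)) + snd w * ((fst p + a) / d))) (at p)"
    by (simp add: d_def)
  have **: "snd p * ((u * d - (fst p + a) * u) / (d * d)) + v * ((fst p + a) / d)
      = v * ((fst p + a) / d) - snd p * (1 + a) / d\<^sup>2 * u" for u v
  proof -
    have "u * d - (fst p + a) * u = - ((1 + a) * u)"
      unfolding x by (simp add: algebra_simps)
    then show ?thesis by (simp only: power2_eq_square) simp
  qed
  have ***: "((\<lambda>q. fst q + a - 1) has_derivative fst) (at p)"
    using fst'[of "a - 1"] by (simp add: algebra_simps)
  show ?thesis
    using has_derivative_Pair[OF * ***, unfolded **] unfolding f_def d_def .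
qed

end

theory Submission
  imports Defs
begin

text \<open>
  The map sends the line \<open>y = t (x - 1)\<close> through \<open>(1, 0)\<close> to the points
  \<open>(t (x + a), x + a - 1)\<close>, that is, to the line of slope \<open>1 / t\<close> through \<open>(0, -1)\<close>. So the
  differential takes the slanted edge of the hatted cone at \<open>p\<close> to the slanted edge of the
  unhatted cone at \<open>f p\<close>, and what remains is to see on which side of it the image lies.

  For \<open>p = (x, y)\<close> write \<open>s = y / (x - 1)\<close> for the slope of the line from \<open>(1, 0)\<close> to \<open>p\<close>, which
  is negative as soon as \<open>f p\<close> lies in one of the regions, and \<open>k = (x + a) / (x - 1)\<close>. The
  differential is \<open>(u, v) \<mapsto> (k v + (1 - k) s u, u)\<close> (lemma \<open>frechet_derivative_f\<close>), so it takes
  slope \<open>m\<close> to \<open>1 / c\<close> with \<open>c = k m + (1 - k) s\<close>, an affine function of \<open>m\<close> that fixes \<open>s\<close>.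
  If \<open>p\<close> is in \<open>R\<^sub>1\<close>, then \<open>m \<le> s\<close>, \<open>k > 0\<close> and \<open>f p\<close> is in \<open>R\<^sub>0\<close>. If \<open>p\<close> is in \<open>R\<^sub>0\<close>, then
  \<open>s \<le> m \<le> 0\<close>, and \<open>f p\<close> is in \<open>R\<^sub>0\<close> or \<open>R\<^sub>1\<close> according as \<open>k\<close> is negative or positive. Whenever
  \<open>f p\<close> is in \<open>R\<^sub>0\<close> this gives \<open>c \<le> s < 0\<close>, so that the image slope is in \<open>[1 / s, 0]\<close>. In the
  remaining case \<open>a < -1\<close> yields \<open>k < 1\<close>, whence \<open>s \<le> c < 0\<close>, and the image slope is at
  most \<open>1 / s\<close>.
\<close>

lemma emb_in_R0_iff: "emb p \<in> R0 \<longleftrightarrow> 1 \<le> fst p \<and> snd p \<le> -1"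
  by (auto simp: emb_def R0_def)

lemma emb_in_R1_iff: "emb p \<in> R1 \<longleftrightarrow> fst p \<le> 0 \<and> 0 \<le> snd p"
  by (auto simp: emb_def R1_def)

text \<open>On the pole \<open>x = 1\<close> the extended map has no finite value, so a finite image puts \<open>p\<close> where
  the affine formula and its derivative are meaningful.\<close>

lemma fbar_emb_eq_emb:
  assumes "fbar a (emb p) = Some (emb q)"
  shows "fst p \<noteq> 1" "q = f a p"
  using assms by (cases p; cases q; auto simp: emb_def split: if_splits)+

text \<open>In these coordinates it is visible that the direction \<open>(1, s)\<close> goes to \<open>(s, 1)\<close>, whatever
  \<open>k\<close> is, and that vertical vectors become horizontal.\<close>

lemma frechet_derivative_f:
  fixes x y a :: real
  assumes "x \<noteq> 1"
  defines "k \<equiv> (x + a) / (x - 1)" and "s \<equiv> y / (x - 1)"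
  shows "frechet_derivative (f a) (at (x, y)) (u, v) = (k * v + (1 - k) * s * u, u)"
proof -
  have "1 - k = - ((1 + a) / (x - 1))"
    using assms(1) unfolding k_def by (simp add: field_simps)
  then have "(1 - k) * s = - (y * (1 + a) / (x - 1)\<^sup>2)"
    by (simp only: s_def power2_eq_square mult_minus_left times_divide_times_eq
        mult.commute[of y])
  moreover have "frechet_derivative (f a) (at (x, y)) =
      (\<lambda>w. (snd w * ((x + a) / (x - 1)) - y * (1 + a) / (x - 1)\<^sup>2 * fst w, fst w))"
    using frechet_derivative_at[OF f_has_derivative[of "(x, y)" a]] assms(1) by simp
  ultimately show ?thesis
    by (simp add: k_def)
qed

text \<open>The slanted edge of the image cone has the direction \<open>(s, 1)\<close>. The exception \<open>x = -a\<close> is the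
  line contracted to the base point \<open>(0, -1)\<close>, which lies in neither region.\<close>

lemma slope_L_f:
  fixes x y a :: real
  assumes "x \<noteq> 1" "y \<noteq> 0" "x + a \<noteq> 0"
  shows "slope_L (f a (x, y)) = ereal (1 / (y / (x - 1)))"
proof -
  have "(x + a) / (y * ((x + a) / (x - 1))) = 1 / (y / (x - 1))"
    using assms by simp
  then show ?thesis
    using assms by (simp add: slope_L_def slope_def f_def add.commute)
qed

lemma slope_Lhat_eq:
  assumes "x \<noteq> 1"
  shows "slope_Lhat (x, y) = ereal (y / (x - 1))"
  using assms by (simp add: slope_Lhat_def slope_def)

lemma slope_image:
  fixes u v k s :: real
  assumes "u \<noteq> 0" "c = k * (v / u) + (1 - k) * s" "c \<noteq> 0"
  shows "slope (k * v + (1 - k) * s * u, u) = ereal (1 / c)"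
proof -
  have "k * v + (1 - k) * s * u = c * u"
    using assms(1,2) by (simp add: field_simps)
  then show ?thesis
    using assms(1,3) by (simp add: slope_def)
qed

theorem theorem5p1:
  fixes a :: real and p q :: "real \<times> real"
  assumes "a < -1"
    and "emb p \<in> R0 \<union> R1"
    and "fbar a (emb p) = Some (emb q)"
    and "emb q \<in> R0 \<union> R1"
  shows "frechet_derivative (f a) (at p) ` Cuhat p \<subseteq> Cu q"
proof (rule image_subsetI)
  fix w assume w: "w \<in> Cuhat p"
  obtain x y where p: "p = (x, y)" by (cases p)
  obtain u v where uv: "w = (u, v)" by (cases w)
  have x1: "x \<noteq> 1" and q: "q = f a (x, y)"
    using fbar_emb_eq_emb[OF assms(3)] by (simp_all add: p)
  define k where "k = (x + a) / (x - 1)"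
  define s where "s = y / (x - 1)"
  define c where "c = k * (v / u) + (1 - k) * s"
  have c: "c = s + k * (v / u - s)" by (simp add: c_def algebra_simps)
  have D: "frechet_derivative (f a) (at p) w = (k * v + (1 - k) * s * u, u)"
    using frechet_derivative_f[OF x1] by (simp add: p uv k_def s_def)
  have q_coords: "fst q = y * k" "snd q = x + a - 1"
    by (simp_all add: q f_def k_def)
  have hat: "slope_Lhat (x, y) = ereal s"
    using slope_Lhat_eq[OF x1] by (simp add: s_def)
  have p_cases: "1 < x \<and> y \<le> -1 \<or> x \<le> 0 \<and> 0 \<le> y"
    using assms(2) x1 by (auto simp: p emb_in_R0_iff emb_in_R1_iff)
  have q_cases: "1 \<le> y * k \<and> x + a \<le> 0 \<or> y * k \<le> 0 \<and> 1 \<le> x + a"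
    using assms(4) by (auto simp: emb_in_R0_iff emb_in_R1_iff q_coords)
  have xa: "x + a \<noteq> 0" using q_cases by (auto simp: k_def)
  have y0: "y \<noteq> 0" using p_cases q_cases assms(1) by auto
  have s_neg: "s < 0"
    using p_cases y0 by (auto simp: s_def divide_less_0_iff)
  have edge: "slope_L q = ereal (1 / s)"
    using slope_L_f[OF x1 y0 xa] by (simp add: q s_def)
  have Cu_R0: "Cu q = {w. w = 0 \<or> ereal (1 / s) \<le> slope w \<and> slope w \<le> 0}"
    if "1 \<le> y * k" "x + a \<le> 0"
    using that by (simp add: Cu_def cone_at_def edge emb_in_R0_iff q_coords)
  have Cu_R1: "Cu q = {w. w = 0 \<or> slope w \<le> ereal (1 / s)}" if "1 \<le> x + a"
    using that by (simp add: Cu_def cone_at_def edge emb_in_R0_iff q_coords)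
  have slope_D: "slope (k * v + (1 - k) * s * u, u) = ereal (1 / c)" if "u \<noteq> 0" "c < 0"
    using slope_image[OF that(1) c_def] that(2) by simp
  show "frechet_derivative (f a) (at p) w \<in> Cu q"
  proof (cases "w = 0")
    case True
    then have "frechet_derivative (f a) (at p) w = 0"
      using D by (simp add: uv zero_prod_def)
    then show ?thesis
      by (simp add: Cu_def cone_at_def)
  next
    case w0: False
    from p_cases show ?thesis
    proof
      assume R0: "1 < x \<and> y \<le> -1"
      then have "ereal s \<le> slope w \<and> slope w \<le> 0"
        using w w0 by (simp add: Cuhat_def cone_at_def hat emb_in_R0_iff p)
      then have u: "u \<noteq> 0" and m: "s \<le> v / u" "v / u \<le> 0"
        by (auto simp: slope_def uv split: if_splits)
      from q_cases show ?thesis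
      proof
        assume Q: "1 \<le> y * k \<and> x + a \<le> 0"
        have "k \<le> 0" using Q R0 by (simp add: k_def divide_nonpos_pos)
        then have "c \<le> s" using m by (simp add: c mult_nonpos_nonneg)
        then have "c < 0" "1 / s \<le> 1 / c"
          using s_neg by (auto simp: divide_simps)
        then show ?thesis
          using Q by (simp add: D Cu_R0 slope_D u)
      next
        assume Q: "y * k \<le> 0 \<and> 1 \<le> x + a"
        have k: "0 \<le> k" "k < 1" using Q R0 assms(1) by (simp_all add: k_def)
        have "s \<le> c" using k m by (simp add: c)
        moreover have "c < 0"
        proof -
          have "k * (v / u) \<le> 0" using k(1) m(2) by (rule mult_nonneg_nonpos)
          moreover have "(1 - k) * s < 0" using k s_neg by (simp add: mult_pos_neg)
          ultimately show ?thesis by (simp add: c_def)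
        qed
        ultimately have "1 / c \<le> 1 / s" "c < 0"
          using s_neg by (auto simp: divide_simps)
        then show ?thesis
          using Q by (simp add: D Cu_R1 slope_D u)
      qed
    next
      assume R1: "x \<le> 0 \<and> 0 \<le> y"
      then have Q: "1 \<le> y * k" "x + a \<le> 0"
        using q_cases assms(1) by auto
      have k: "0 \<le> k" using Q R1 by (simp add: k_def divide_nonpos_neg)
      have m: "slope w \<le> ereal s"
        using w w0 R1 by (simp add: Cuhat_def cone_at_def hat emb_in_R0_iff p)
      show ?thesis
      proof (cases "u = 0")
        case True
        \<comment> \<open>The hatted cone over \<open>R\<^sub>1\<close> reaches the vertical, and its image is horizontal.\<close>
        have "k * v = 0 \<or> slope (k * v, 0) = 0"
          by (simp add: slope_def)
        moreover have "1 / s \<le> 0" using s_neg by simp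
        ultimately show ?thesis
          using True Q by (auto simp: D Cu_R0 zero_prod_def)
      next
        case u: False
        then have "v / u \<le> s" using m by (simp add: slope_def uv)
        then have "c \<le> s" using k by (simp add: c mult_nonneg_nonpos)
        then have "c < 0" "1 / s \<le> 1 / c"
          using s_neg by (auto simp: divide_simps)
        then show ?thesis
          using Q by (simp add: D Cu_R0 slope_D u)
      qed
    qed
  qed
qed

end
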